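(* Let $V$ be a finite-dimensional Hilbert space over $F\in\{\mathbb{R},\mathbb{C}\}$, let $G\leq\operatorname{Aut}(V)$ be a finite subgroup, and let $k$ be a positive integer. If $k\geq[\mathbb{C}:F]$, then for generic $(v_1,\dots,v_k)\in V^k$, the canonical map $G\to\operatorname{Aut}(Gv_1\cup\dots\cup Gv_k)$, $g\mapsto g|_{Gv_1\cup\dots\cup Gv_k}$, is a group isomorphism.
   Context: $[\mathbb{C}:F]$ is the degree of the field extension $\mathbb{C}/F$ ($1$ if $F=\mathbb{C}$, $2$ if $F=\mathbb{R}$). For a subset $S\subseteq V$, $\operatorname{Aut}(S)$ denotes the group of permutations $\sigma\colon S\to S$ for which there exists a linear isometry $M\colon V\to V$ with $M|_S=\sigma$; in particular, $\operatorname{Aut}(V)$ is the unitary group $\operatorname{U}(V)$ if $F=\mathbb{C}$ and the orthogonal group $\operatorname{O}(V)$ if $F=\mathbb{R}$. $Gv=\{gv: g\in G\}$ denotes the orbit of $v$. Genericity: a subset of a topological space $X$ is generic if it is open and dense in $X$; a condition holds for generic $x\in X$ if there is a generic subset of $X$ on which it holds. $V^k$ carries its usual topology. *)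

theory Defs
  imports "HOL-Analysis.Analysis" "HOL-Algebra.Bij"
begin

section \<open>The scalar field\<close>

text \<open>
  A scalar field in this class is, up to isomorphism, \<open>\<real>\<close> or \<open>\<complex>\<close>: the map \<open>to_complex\<close> is a
  ring homomorphism between fields, hence injective, and it identifies the type with the
  subfield \<open>\<real>\<close> or \<open>\<complex>\<close> of \<open>\<complex>\<close>.
\<close>

class real_or_complex = field +
  fixes to_complex :: "'a \<Rightarrow> complex"
  assumes to_complex_add: "to_complex (a + b) = to_complex a + to_complex b"
    and to_complex_mult: "to_complex (a * b) = to_complex a * to_complex b"
    and to_complex_one: "to_complex 1 = 1"
    and range_to_complex: "range to_complex = \<real> \<or> range to_complex = UNIV"

instantiation real :: real_or_complex
begin
definition to_complex_real :: "real \<Rightarrow> complex" where "to_complex_real = complex_of_real"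
instance by standard (auto simp: to_complex_real_def Reals_def)
end

instantiation complex :: real_or_complex
begin
definition to_complex_complex :: "complex \<Rightarrow> complex" where "to_complex_complex = id"
instance by standard (auto simp: to_complex_complex_def)
end

text \<open>The degree \<open>[\<complex> : F]\<close>, with \<open>\<complex>\<close> regarded as a vector space over \<open>F\<close>.\<close>

definition complex_degree :: "'f::real_or_complex itself \<Rightarrow> nat" where
  "complex_degree _ = vector_space.dim (\<lambda>(a::'f) z. to_complex a * z) (UNIV :: complex set)"

lemma vector_space_complex:
  "vector_space (\<lambda>(a::'f::real_or_complex) z. to_complex a * z)"
  by unfold_locales
    (simp_all add: to_complex_add to_complex_mult to_complex_one algebra_simps)

lemma complex_degree_real: "complex_degree TYPE(real) = 2"
proof -
  have "(\<lambda>(a::real) z. to_complex a * z) = scaleR"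
    by (auto simp: to_complex_real_def fun_eq_iff scaleR_conv_of_real)
  then show ?thesis
    by (simp add: complex_degree_def dim_raw_def [symmetric])
qed

lemma complex_degree_complex: "complex_degree TYPE(complex) = 1"
proof -
  have "(\<lambda>(a::complex) z. to_complex a * z) = (*)"
    by (auto simp: to_complex_complex_def fun_eq_iff)
  then show ?thesis
    using dimension_eq_1 [where 'a = complex]
    by (simp add: complex_degree_def vector_space_over_itself.dim_UNIV)
qed


section \<open>Finite-dimensional Hilbert spaces\<close>

text \<open>
  The inner product is linear in its first argument. Completeness is automatic in finite
  dimension. The space of dimension \<open>0\<close> is allowed.
\<close>

locale finite_dim_hilbert_space = vector_space scl
  for scl :: "'f::real_or_complex \<Rightarrow> 'v::ab_group_add \<Rightarrow> 'v" +
  fixes ip :: "'v \<Rightarrow> 'v \<Rightarrow> 'f"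
  assumes finite_dim: "\<exists>B. finite B \<and> span B = UNIV"
    and ip_add_left: "ip (x + y) z = ip x z + ip y z"
    and ip_scale_left: "ip (scl a x) y = a * ip x y"
    and ip_cnj: "to_complex (ip y x) = cnj (to_complex (ip x y))"
    and ip_pos: "x \<noteq> 0 \<Longrightarrow> Re (to_complex (ip x x)) > 0"

definition ip_norm :: "('v \<Rightarrow> 'v \<Rightarrow> 'f::real_or_complex) \<Rightarrow> 'v \<Rightarrow> real" where
  "ip_norm ip x = sqrt (Re (to_complex (ip x x)))"

definition ip_topology :: "('v::ab_group_add \<Rightarrow> 'v \<Rightarrow> 'f::real_or_complex) \<Rightarrow> 'v topology" where
  "ip_topology ip = Metric_space.mtopology UNIV (\<lambda>x y. ip_norm ip (x - y))"

definition linear_isometry ::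
    "('f::real_or_complex \<Rightarrow> 'v::ab_group_add \<Rightarrow> 'v) \<Rightarrow> ('v \<Rightarrow> 'v \<Rightarrow> 'f) \<Rightarrow> ('v \<Rightarrow> 'v) \<Rightarrow> bool" where
  "linear_isometry scl ip M \<longleftrightarrow>
     Vector_Spaces.linear scl scl M \<and> (\<forall>x. ip_norm ip (M x) = ip_norm ip x)"

text \<open>
  As in \<^const>\<open>BijGroup\<close>, permutations of \<open>S\<close> are represented by functions
  that are \<^const>\<open>undefined\<close> outside \<open>S\<close>.
\<close>

definition Aut ::
    "('f::real_or_complex \<Rightarrow> 'v::ab_group_add \<Rightarrow> 'v) \<Rightarrow> ('v \<Rightarrow> 'v \<Rightarrow> 'f) \<Rightarrow> 'v set \<Rightarrow> ('v \<Rightarrow> 'v) monoid" where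
  "Aut scl ip S = (BijGroup S)
     \<lparr>carrier := {\<sigma> \<in> Bij S. \<exists>M. linear_isometry scl ip M \<and> (\<forall>x\<in>S. M x = \<sigma> x)}\<rparr>"

definition orbit_of :: "('v \<Rightarrow> 'v) set \<Rightarrow> 'v \<Rightarrow> 'v set" where
  "orbit_of G v = {g v | g. g \<in> G}"


section \<open>Genericity\<close>

definition generic_set :: "'x topology \<Rightarrow> 'x set \<Rightarrow> bool" where
  "generic_set X S \<longleftrightarrow> openin X S \<and> X closure_of S = topspace X"

definition holds_generically :: "'x topology \<Rightarrow> ('x \<Rightarrow> bool) \<Rightarrow> bool" where
  "holds_generically X P \<longleftrightarrow> (\<exists>S. generic_set X S \<and> (\<forall>x\<in>S. P x))"


section \<open>Well-definedness\<close>

context finite_dim_hilbert_space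
begin

abbreviation Re_ip :: "'v \<Rightarrow> 'v \<Rightarrow> real" where
  "Re_ip x y \<equiv> Re (to_complex (ip x y))"

lemma Re_ip_add_left: "Re_ip (x + y) z = Re_ip x z + Re_ip y z"
  by (simp add: ip_add_left to_complex_add)

lemma Re_ip_sym: "Re_ip x y = Re_ip y x"
  by (simp add: ip_cnj [of x y])

lemma Re_ip_add_right: "Re_ip z (x + y) = Re_ip z x + Re_ip z y"
  by (metis Re_ip_add_left Re_ip_sym)

lemma Re_ip_zero: "Re_ip 0 x = 0"
  using Re_ip_add_left [of 0 0 x] by simp

lemma Re_ip_minus_left: "Re_ip (- x) y = - Re_ip x y"
  using Re_ip_add_left [of x "- x" y] Re_ip_zero [of y] by simp

lemma Re_ip_nonneg: "Re_ip x x \<ge> 0"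
  using ip_pos [of x] Re_ip_zero [of 0] by (cases "x = 0") auto

lemma real_scalar: "\<exists>a::'f. to_complex a = complex_of_real r"
proof -
  have "complex_of_real r \<in> range (to_complex :: 'f \<Rightarrow> complex)"
    using range_to_complex [where 'a = 'f] by auto
  then show ?thesis by (metis imageE)
qed

lemma Re_ip_Cauchy_Schwarz: "(Re_ip x y)\<^sup>2 \<le> Re_ip x x * Re_ip y y"
proof (cases "y = 0")
  case True
  then show ?thesis by (metis Re_ip_sym Re_ip_zero mult_zero_right order_refl power_zero_numeral)
next
  case False
  then have pos: "Re_ip y y > 0" by (rule ip_pos)
  define r where "r = - (Re_ip x y / Re_ip y y)"
  obtain a :: 'f where a: "to_complex a = complex_of_real r" using real_scalar by blast
  have s: "Re_ip (scl a u) v = r * Re_ip u v" for u v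
    by (simp add: ip_scale_left to_complex_mult a)
  have s': "Re_ip v (scl a u) = r * Re_ip v u" for u v
    by (metis s Re_ip_sym)
  have "0 \<le> Re_ip (x + scl a y) (x + scl a y)" by (rule Re_ip_nonneg)
  also have "\<dots> = Re_ip x x + 2 * r * Re_ip x y + r\<^sup>2 * Re_ip y y"
    by (simp only: Re_ip_add_left Re_ip_add_right s s' Re_ip_sym [of y x])
       (simp add: power2_eq_square algebra_simps)
  also have "\<dots> = Re_ip x x - (Re_ip x y)\<^sup>2 / Re_ip y y"
    using pos by (simp add: r_def field_simps power2_eq_square)
  finally show ?thesis using pos by (simp add: field_simps)
qed

lemma ip_norm_triangle: "ip_norm ip (x + y) \<le> ip_norm ip x + ip_norm ip y"
proof -
  have "Re_ip x y \<le> sqrt (Re_ip x x) * sqrt (Re_ip y y)"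
    using Re_ip_Cauchy_Schwarz [of x y]
    by (metis abs_le_D1 real_sqrt_abs real_sqrt_le_mono real_sqrt_mult)
  then have "Re_ip (x + y) (x + y) \<le> (sqrt (Re_ip x x) + sqrt (Re_ip y y))\<^sup>2"
    using Re_ip_nonneg [of x] Re_ip_nonneg [of y]
    by (simp add: Re_ip_add_left Re_ip_add_right Re_ip_sym [of y x] power2_sum)
  then show ?thesis
    unfolding ip_norm_def using Re_ip_nonneg by (simp add: real_le_lsqrt)
qed

lemma ip_norm_eq_0_iff: "ip_norm ip x = 0 \<longleftrightarrow> x = 0"
  using ip_pos [of x] Re_ip_zero [of 0] by (cases "x = 0") (auto simp: ip_norm_def)

lemma ip_norm_minus: "ip_norm ip (- x) = ip_norm ip x"
  unfolding ip_norm_def by (metis Re_ip_minus_left Re_ip_sym minus_minus)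

lemma Metric_space_ip_norm: "Metric_space UNIV (\<lambda>x y. ip_norm ip (x - y))"
proof
  show "0 \<le> ip_norm ip (x - y)" for x y
    by (simp add: ip_norm_def Re_ip_nonneg)
  show "ip_norm ip (x - y) = ip_norm ip (y - x)" for x y
    by (metis ip_norm_minus minus_diff_eq)
  show "ip_norm ip (x - y) = 0 \<longleftrightarrow> x = y" for x y
    by (simp add: ip_norm_eq_0_iff)
  show "ip_norm ip (x - z) \<le> ip_norm ip (x - y) + ip_norm ip (y - z)" for x y z
    using ip_norm_triangle [of "x - y" "y - z"] by simp
qed

lemma linear_isometry_id: "linear_isometry scl ip (\<lambda>x. x)"
  unfolding linear_isometry_def
  by (simp add: Vector_Spaces.linear_iff vector_space_axioms scale_right_distrib)

lemma linear_isometry_comp: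
  assumes "linear_isometry scl ip M" "linear_isometry scl ip N"
  shows "linear_isometry scl ip (\<lambda>x. M (N x))"
  using assms Vector_Spaces.linear_compose [of scl scl N scl M]
  by (auto simp: linear_isometry_def o_def)

lemma linear_isometry_inv:
  assumes M: "linear_isometry scl ip M"
  shows "bij M" "linear_isometry scl ip (inv_into UNIV M)"
proof -
  obtain B where B: "finite B" "span B = UNIV" using finite_dim by blast
  obtain C where C: "C \<subseteq> B" "independent C" "B \<subseteq> span C"
    by (rule maximal_independent_subset)
  then have sC: "span C = UNIV"
    using span_minimal [of B "span C"] B(2) by auto
  have "finite C" using C(1) B(1) by (rule finite_subset)
  interpret V: finite_dimensional_vector_space scl C
    by unfold_locales (fact \<open>finite C\<close> C(2) sC)+
  have lin: "Vector_Spaces.linear scl scl M" using M by (simp add: linear_isometry_def)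
  interpret L: Vector_Spaces.linear scl scl M by (rule lin)
  have "inj M"
  proof (rule injI)
    fix x y assume "M x = M y"
    then have "M (x - y) = 0" by (simp add: L.diff)
    then have "ip_norm ip (x - y) = 0"
      using M by (metis linear_isometry_def ip_norm_eq_0_iff)
    then show "x = y" by (simp add: ip_norm_eq_0_iff)
  qed
  then show bij: "bij M"
    using V.linear_inj_imp_surj [OF lin] by (simp add: bij_def)
  then have iM: "M (inv_into UNIV M x) = x" for x by (simp add: bij_is_surj surj_f_inv_f)
  have "inv_into UNIV M (x + y) = inv_into UNIV M x + inv_into UNIV M y" for x y
    by (rule injD [OF \<open>inj M\<close>]) (simp only: iM L.add)
  moreover have "inv_into UNIV M (scl a x) = scl a (inv_into UNIV M x)" for a x
    by (rule injD [OF \<open>inj M\<close>]) (simp only: iM L.scale)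
  ultimately have "Vector_Spaces.linear scl scl (inv_into UNIV M)"
    by (simp add: Vector_Spaces.linear_iff vector_space_axioms)
  moreover have "ip_norm ip (inv_into UNIV M x) = ip_norm ip x" for x
    using M iM by (metis linear_isometry_def)
  ultimately show "linear_isometry scl ip (inv_into UNIV M)" by (simp add: linear_isometry_def)
qed

lemma subgroup_Aut: "subgroup (carrier (Aut scl ip S)) (BijGroup S)"
proof (rule group.subgroupI [OF group_BijGroup])
  show "carrier (Aut scl ip S) \<subseteq> carrier (BijGroup S)"
    by (auto simp: Aut_def BijGroup_def)
  have "(\<lambda>x\<in>S. x) \<in> carrier (Aut scl ip S)"
    using linear_isometry_id by (auto simp: Aut_def id_Bij)
  then show "carrier (Aut scl ip S) \<noteq> {}" by blast
next
  fix \<sigma> assume "\<sigma> \<in> carrier (Aut scl ip S)"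
  then obtain M where s: "\<sigma> \<in> Bij S" and M: "linear_isometry scl ip M" "\<forall>x\<in>S. M x = \<sigma> x"
    by (auto simp: Aut_def)
  have inv: "inv\<^bsub>BijGroup S\<^esub> \<sigma> = (\<lambda>x\<in>S. inv_into S \<sigma> x)"
    by (rule inv_BijGroup [OF s])
  have "inv_into UNIV M x = inv_into S \<sigma> x" if "x \<in> S" for x
  proof -
    have y: "inv_into S \<sigma> x \<in> S" "\<sigma> (inv_into S \<sigma> x) = x"
      using s that by (auto simp: Bij_def bij_betw_def inv_into_into f_inv_into_f)
    then have "M (inv_into S \<sigma> x) = x" using M by simp
    then show ?thesis
      using linear_isometry_inv(1) [OF M(1)] by (metis bij_inv_eq_iff)
  qed
  then show "inv\<^bsub>BijGroup S\<^esub> \<sigma> \<in> carrier (Aut scl ip S)"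
    unfolding inv using linear_isometry_inv(2) [OF M(1)] restrict_inv_into_Bij [OF s]
    by (auto simp: Aut_def)
next
  fix \<sigma> \<tau> assume "\<sigma> \<in> carrier (Aut scl ip S)" "\<tau> \<in> carrier (Aut scl ip S)"
  then obtain M N where s: "\<sigma> \<in> Bij S" "\<tau> \<in> Bij S"
    and M: "linear_isometry scl ip M" "\<forall>x\<in>S. M x = \<sigma> x"
    and N: "linear_isometry scl ip N" "\<forall>x\<in>S. N x = \<tau> x"
    by (auto simp: Aut_def)
  have "M (N x) = compose S \<sigma> \<tau> x" if "x \<in> S" for x
    using that M N s Bij_imp_funcset [of \<tau> S] by (auto simp: compose_eq)
  then show "\<sigma> \<otimes>\<^bsub>BijGroup S\<^esub> \<tau> \<in> carrier (Aut scl ip S)"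
    using linear_isometry_comp [OF M(1) N(1)] s
    by (auto simp: Aut_def BijGroup_def compose_Bij)
qed

lemma group_Aut: "group (Aut scl ip S)"
proof -
  have "Aut scl ip S = (BijGroup S)\<lparr>carrier := carrier (Aut scl ip S)\<rparr>"
    by (simp add: Aut_def)
  then show ?thesis
    by (metis subgroup.subgroup_is_group [OF subgroup_Aut group_BijGroup])
qed

end

end

theory Submission
  imports Defs
begin

text \<open>
  Two kinds of conditions on a tuple \<open>v\<close> make the union \<open>S\<close> of the orbits of its entries rigid.
  First, equal norms occur only for equal vectors. An isometry that maps \<open>S\<close> into itself then
  maps each orbit into itself, because an orbit lies on a sphere. Second, the pair \<open>(i, j)\<close>
  separates \<open>G\<close>: the scalars \<open>ip (v i) (g (v j))\<close> are pairwise distinct for \<open>g \<in> G\<close>. An isometry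
  of this kind that fixes \<open>v i\<close> then fixes every point \<open>g (v j)\<close>, since its inner product with
  \<open>v i\<close> identifies it within the orbit.

  Given an automorphism of \<open>S\<close> induced by an isometry \<open>M\<close>, the norms provide \<open>g \<in> G\<close> with
  \<open>M (v 0) = g (v 0)\<close>, so that \<open>inverse g \<circ> M\<close> fixes \<open>v 0\<close>. Separation by the pairs \<open>(0, j)\<close> with
  \<open>j \<noteq> 0\<close> shows that it fixes the other orbits, and separation by \<open>(1, 0)\<close> that it fixes the orbit
  of \<open>v 0\<close> as well; for \<open>k = 1\<close> the pair \<open>(0, 0)\<close> takes over. Hence \<open>M\<close> agrees with \<open>g\<close> on \<open>S\<close>
  (\<open>isometry_fixes_orbits\<close>, \<open>restriction_iso\<close>).

  It remains to see that these finitely many conditions are generic. In the zero space they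
  are trivial. Otherwise each of them follows from the nonvanishing of a continuous function that
  is a quadratic polynomial along every real line. Such a function vanishes only finitely often on the line through an arbitrary tuple and
  a tuple where it does not vanish, so its nonvanishing locus is dense as soon as it is nonempty
  (\<open>real_quadratic_generically_nonzero\<close>).

  The bound on \<open>k\<close> is what makes these loci nonempty. For \<open>i \<noteq> j\<close> a tuple separating \<open>g\<close> and \<open>h\<close>
  is obtained by choosing \<open>x\<close> with \<open>g x \<noteq> h x\<close> and the entries \<open>g x - h x\<close> and \<open>x\<close>. For \<open>i = j\<close>
  one needs \<open>x\<close> with \<open>ip x (g x) \<noteq> ip x (h x)\<close>. Complex polarization yields one
  (\<open>complex_ip_eqI\<close>), whereas over the reals the quadratic form of \<open>g - h\<close> is zero if \<open>g - h\<close>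
  is skew. The pair \<open>(0, 0)\<close> is needed only for \<open>k = 1\<close>, and \<open>k = 1\<close> forces the field to
  be complex (\<open>complex_degree_eq_2\<close>).
\<close>

section \<open>Generic conditions\<close>

lemma holds_generically_mono:
  assumes "holds_generically X P" "\<And>x. x \<in> topspace X \<Longrightarrow> P x \<Longrightarrow> Q x"
  shows "holds_generically X Q"
  using assms unfolding holds_generically_def generic_set_def by (meson openin_subset subsetD)

lemma holds_generically_everywhere:
  assumes "\<And>x. x \<in> topspace X \<Longrightarrow> P x"
  shows "holds_generically X P"
  using assms unfolding holds_generically_def generic_set_def
  by (intro exI [of _ "topspace X"]) simp

lemma holds_generically_conj:
  assumes "holds_generically X P" "holds_generically X Q"
  shows "holds_generically X (\<lambda>x. P x \<and> Q x)"
proof -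
  obtain S T where S: "openin X S" "X closure_of S = topspace X" "\<forall>x\<in>S. P x"
    and T: "openin X T" "X closure_of T = topspace X" "\<forall>x\<in>T. Q x"
    using assms unfolding holds_generically_def generic_set_def by blast
  have "X closure_of (S \<inter> T) = X closure_of (S \<inter> X closure_of T)"
    using closure_of_openin_Int_closure_of [OF S(1)] by metis
  also have "\<dots> = topspace X"
    using S T openin_subset [of X S] by (simp add: Int_absorb2)
  finally show ?thesis
    using S T unfolding holds_generically_def generic_set_def
    by (intro exI [of _ "S \<inter> T"]) (auto intro: openin_Int)
qed

lemma holds_generically_ball:
  assumes "finite A" "\<And>a. a \<in> A \<Longrightarrow> holds_generically X (P a)"
  shows "holds_generically X (\<lambda>x. \<forall>a\<in>A. P a x)"
  using assms
proof (induction A rule: finite_induct)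
  case empty
  show ?case by (rule holds_generically_everywhere) simp
next
  case (insert a A)
  then show ?case using holds_generically_conj [of X "P a" "\<lambda>x. \<forall>b\<in>A. P b x"] by simp
qed

lemma quadratic_finite_zeros:
  fixes a b c :: real
  assumes "a + b * s + c * s\<^sup>2 \<noteq> 0"
  shows "finite {t. a + b * t + c * t\<^sup>2 = 0}"
proof -
  have eq: "poly [:a, b, c:] t = a + b * t + c * t\<^sup>2" for t
    by (simp add: power2_eq_square algebra_simps)
  then have "[:a, b, c:] \<noteq> 0" using assms by (metis poly_0)
  then have "finite {t. poly [:a, b, c:] t = 0}" by (rule poly_roots_finite)
  then show ?thesis by (simp only: eq)
qed


section \<open>Scalars\<close>

lemma to_complex_zero: "to_complex (0::'f::real_or_complex) = 0"
  using to_complex_add [of "0::'f" 0] by simp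

lemma to_complex_diff:
  "to_complex (a - b :: 'f::real_or_complex) = to_complex a - to_complex b"
  using to_complex_add [of "a - b" b] by simp

lemma to_complex_eq_0_iff: "to_complex (a::'f::real_or_complex) = 0 \<longleftrightarrow> a = 0"
proof
  assume "to_complex a = 0"
  then have "to_complex (a * inverse a) = 0" by (simp add: to_complex_mult)
  then show "a = 0" by (metis right_inverse to_complex_one zero_neq_one)
qed (simp add: to_complex_zero)

lemma to_complex_eq_iff: "to_complex a = to_complex (b::'f::real_or_complex) \<longleftrightarrow> a = b"
  using to_complex_eq_0_iff [of "a - b"] by (simp add: to_complex_diff)

lemma complex_degree_eq_2:
  assumes "range (to_complex :: 'f::real_or_complex \<Rightarrow> complex) = \<real>"
  shows "complex_degree TYPE('f) = 2"
proof -
  interpret C: vector_space "\<lambda>(a::'f) z. to_complex a * z" by (rule vector_space_complex)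
  have real: "to_complex (a::'f) \<in> \<real>" for a using assms by blast
  have indep: "C.independent {1, \<i>}"
  proof -
    have "\<i> \<notin> \<real>" by (simp add: complex_is_Real_iff)
    moreover have "C.span {1} \<subseteq> \<real>"
      using real by (auto simp: C.span_singleton)
    ultimately have "\<i> \<notin> C.span {1}" by blast
    moreover have "C.independent {1}" by (rule C.independent_insertI) (auto simp: C.independent_empty)
    ultimately have "C.independent {\<i>, 1}" by (rule C.independent_insertI)
    then show ?thesis by (simp add: insert_commute)
  qed
  have "z \<in> C.span {1, \<i>}" for z
  proof -
    obtain a b :: 'f where "complex_of_real (Re z) = to_complex a" "complex_of_real (Im z) = to_complex b"
      using assms by (metis Reals_of_real imageE)
    then have "z = to_complex a * 1 + to_complex b * \<i>"
      by (simp add: complex_eq_iff flip: \<open>complex_of_real (Re z) = _\<close> \<open>complex_of_real (Im z) = _\<close>)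
    then show ?thesis
      by (metis C.span_add C.span_base C.span_scale insertCI)
  qed
  then have "C.dim UNIV = 2"
    by (intro C.dim_unique [OF _ _ indep]) (auto simp: complex_eq_iff)
  then show ?thesis by (simp add: complex_degree_def)
qed


section \<open>The inner product\<close>

context finite_dim_hilbert_space
begin

lemma ip_add_right: "ip x (y + z) = ip x y + ip x z"
proof -
  have "to_complex (ip x (y + z)) = to_complex (ip x y + ip x z)"
    by (metis ip_cnj ip_add_left to_complex_add complex_cnj_add)
  then show ?thesis
    by (simp only: to_complex_eq_iff)
qed

lemma to_complex_ip_scale_right:
  "to_complex (ip x (scl a y)) = cnj (to_complex a) * to_complex (ip x y)"
  by (metis ip_cnj ip_scale_left to_complex_mult complex_cnj_mult)

lemma ip_diff_right: "ip x (y - z) = ip x y - ip x z"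
  using ip_add_right [of x "y - z" z] by simp

lemma ip_self_eq_0_iff: "ip x x = 0 \<longleftrightarrow> x = 0"
  using ip_pos [of x] ip_scale_left [of 0 0 0] by (cases "x = 0") (auto simp: to_complex_zero)

lemma ip_norm_power2: "(ip_norm ip x)\<^sup>2 = Re_ip x x"
  by (simp add: ip_norm_def Re_ip_nonneg)

lemma Re_ip_polarization:
  "Re_ip x y = ((ip_norm ip x)\<^sup>2 + (ip_norm ip y)\<^sup>2 - (ip_norm ip (x - y))\<^sup>2) / 2"
proof -
  have "Re_ip (x - y) (x - y) = Re_ip x x - Re_ip x y - Re_ip y x + Re_ip y y"
    by (simp add: Re_ip_add_left [of x "- y", simplified] Re_ip_minus_left
        ip_diff_right to_complex_diff)
  then show ?thesis unfolding ip_norm_power2 using Re_ip_sym [of x y] by simp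
qed

text \<open>
  Norms determine the real part of the inner product. For the whole inner product, let \<open>d\<close> be
  the defect \<open>ip (M x) (M y) - ip x y\<close>: scaling \<open>x\<close> by \<open>a\<close> shows that \<open>a * d\<close> has real part \<open>0\<close>
  for every scalar \<open>a\<close>, in particular for the conjugate of \<open>d\<close>. This treats both fields at once.
\<close>

lemma linear_isometry_ip:
  assumes "linear_isometry scl ip M"
  shows "ip (M x) (M y) = ip x y"
proof -
  have norm: "ip_norm ip (M u) = ip_norm ip u" for u
    using assms by (simp add: linear_isometry_def)
  interpret L: Vector_Spaces.linear scl scl M
    using assms by (simp add: linear_isometry_def)
  have Re: "Re_ip (M u) (M v) = Re_ip u v" for u v
    unfolding Re_ip_polarization by (simp add: norm flip: L.diff)
  define d where "d = ip (M x) (M y) - ip x y"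
  \<comment> \<open>Swapping the arguments gives the conjugate of \<open>d\<close> as an element of the scalar field.\<close>
  define a where "a = ip (M y) (M x) - ip y x"
  have a: "to_complex a = cnj (to_complex d)"
    unfolding a_def d_def to_complex_diff complex_cnj_diff by (metis ip_cnj)
  have "Re (to_complex (a * d)) = Re_ip (M (scl a x)) (M y) - Re_ip (scl a x) y"
    by (simp add: d_def L.scale ip_scale_left to_complex_mult to_complex_diff algebra_simps)
  then have "Re (to_complex (a * d)) = 0" by (simp add: Re)
  then have "to_complex d = 0"
    by (simp add: to_complex_mult a complex_eq_iff flip: power2_eq_square)
  then show ?thesis by (simp add: to_complex_eq_0_iff d_def)
qed

text \<open>
  The sesquilinear form \<open>t u v = ip u (A v - B v)\<close> vanishes on the diagonal, hence is
  skew. Skewness at \<open>\<i> u\<close> and \<open>v\<close> makes it symmetric too, so it vanishes, and \<open>u = A y - B y\<close>,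
  \<open>v = y\<close> gives the equality of the maps.
\<close>

lemma complex_ip_eqI:
  assumes surj: "range (to_complex :: 'f \<Rightarrow> complex) = UNIV"
    and "Vector_Spaces.linear scl scl A" "Vector_Spaces.linear scl scl B"
    and eq: "\<And>x. ip x (A x) = ip x (B x)"
  shows "A = B"
proof
  fix y
  interpret A: Vector_Spaces.linear scl scl A by fact
  interpret B: Vector_Spaces.linear scl scl B by fact
  define C where "C = (\<lambda>x. A x - B x)"
  define t where "t u v = to_complex (ip u (C v))" for u v
  have t0: "t x x = 0" for x by (simp add: t_def C_def ip_diff_right eq to_complex_zero)
  have t_add: "t (u + u') v = t u v + t u' v" "t u (v + v') = t u v + t u v'" for u u' v v'
    by (simp_all add: t_def C_def ip_add_left ip_diff_right ip_add_right to_complex_diff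
        to_complex_add A.add B.add algebra_simps)
  have skew: "t u v = - t v u" for u v
  proof -
    have "t u u + t v u + (t u v + t v v) = 0"
      using t0 [of "u + v"] by (simp only: t_add)
    then show ?thesis by (simp add: t0 eq_neg_iff_add_eq_0 add.commute)
  qed
  obtain c :: 'f where c: "to_complex c = \<i>" using surj by (metis UNIV_I imageE)
  have t_c: "t (scl c u) v = \<i> * t u v" "t u (scl c v) = - \<i> * t u v" for u v
  proof -
    show "t (scl c u) v = \<i> * t u v"
      by (simp add: t_def ip_scale_left to_complex_mult c)
    have "C (scl c v) = scl c (C v)"
      by (simp add: C_def A.scale B.scale scale_right_diff_distrib)
    then show "t u (scl c v) = - \<i> * t u v"
      by (simp add: t_def to_complex_ip_scale_right c)
  qed
  have "t u v = 0" for u v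
  proof -
    have "\<i> * t u v = \<i> * t v u"
      using skew [of "scl c u" v] by (simp add: t_c)
    then have "t u v = t v u" by simp
    then show ?thesis using skew [of u v] by simp
  qed
  then have "ip (C y) (C y) = 0" by (simp add: t_def to_complex_eq_0_iff)
  then show "A y = B y" by (simp add: ip_self_eq_0_iff C_def)
qed


section \<open>Nonvanishing of real quadratic functions\<close>

interpretation N: Metric_space UNIV "\<lambda>x y. ip_norm ip (x - y)"
  by (rule Metric_space_ip_norm)

lemma topspace_ip_topology [simp]: "topspace (ip_topology ip) = UNIV"
  by (simp add: ip_topology_def)

lemma continuous_map_ip_norm_diff:
  assumes "continuous_map X (ip_topology ip) f" "continuous_map X (ip_topology ip) g"
  shows "continuous_map X euclideanreal (\<lambda>x. ip_norm ip (f x - g x))"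
  using continuous_map_mdist [of X N.Self f g] assms
  by (simp add: ip_topology_def mtopology_of_def)

lemma continuous_map_Re_ip:
  assumes "continuous_map X (ip_topology ip) f" "continuous_map X (ip_topology ip) g"
  shows "continuous_map X euclideanreal (\<lambda>x. Re_ip (f x) (g x))"
proof -
  have norm: "continuous_map X euclideanreal (\<lambda>x. ip_norm ip (h x))"
    if "continuous_map X (ip_topology ip) h" for h
    using continuous_map_ip_norm_diff [OF that, of "\<lambda>_. 0"] by simp
  have "continuous_map X euclideanreal
      (\<lambda>x. ((ip_norm ip (f x))\<^sup>2 + (ip_norm ip (g x))\<^sup>2 - (ip_norm ip (f x - g x))\<^sup>2) * (1/2))"
    using assms by (intro continuous_intros norm continuous_map_ip_norm_diff)
      (simp_all add: ip_topology_def)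
  then show ?thesis by (simp add: Re_ip_polarization)
qed

lemma ip_norm_scale: "ip_norm ip (scl a x) = cmod (to_complex a) * ip_norm ip x"
proof -
  have "to_complex (ip (scl a x) (scl a x)) = complex_of_real ((cmod (to_complex a))\<^sup>2) * to_complex (ip x x)"
    by (simp add: ip_scale_left to_complex_mult to_complex_ip_scale_right complex_norm_square
        mult.assoc del: of_real_power)
  then show ?thesis by (simp add: ip_norm_def real_sqrt_mult)
qed

text \<open>
  Continuity with a modulus \<open>h\<close> that may depend on the point; all maps needed below are
  Lipschitz in terms of a map already known to be continuous.
\<close>

lemma continuous_map_into_ip_topologyI:
  assumes "\<And>x. x \<in> topspace X \<Longrightarrow>
     \<exists>h. continuous_map X euclideanreal h \<and> h x = 0 \<and> (\<forall>y\<in>topspace X. ip_norm ip (f x - f y) \<le> h y)"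
  shows "continuous_map X (ip_topology ip) f"
  unfolding ip_topology_def N.continuous_map_to_metric
proof (intro ballI allI impI)
  fix x and e :: real assume x: "x \<in> topspace X" and "e > 0"
  obtain h where h: "continuous_map X euclideanreal h" "h x = 0"
      "\<forall>y\<in>topspace X. ip_norm ip (f x - f y) \<le> h y" using assms [OF x] by blast
  have "openin X {y \<in> topspace X. h y \<in> {..<e}}"
    by (rule openin_continuous_map_preimage [OF h(1)]) simp
  then show "\<exists>U. openin X U \<and> x \<in> U \<and> (\<forall>y\<in>U. f y \<in> N.mball (f x) e)"
    using h x \<open>e > 0\<close> by (intro exI [of _ "{y \<in> topspace X. h y \<in> {..<e}}"]) force
qed

lemma continuous_map_scaled:
  assumes f: "continuous_map X (ip_topology ip) f"
  shows "continuous_map X (ip_topology ip) (\<lambda>x. scl a (f x))"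
proof (rule continuous_map_into_ip_topologyI)
  fix x
  show "\<exists>h. continuous_map X euclideanreal h \<and> h x = 0 \<and>
      (\<forall>y\<in>topspace X. ip_norm ip (scl a (f x) - scl a (f y)) \<le> h y)"
    using f by (intro exI [of _ "\<lambda>y. cmod (to_complex a) * ip_norm ip (f x - f y)"] conjI
        continuous_map_real_mult_left continuous_map_ip_norm_diff)
      (auto simp: ip_norm_eq_0_iff ip_norm_scale simp flip: scale_right_diff_distrib)
qed

lemma continuous_map_linear_isometry:
  assumes M: "linear_isometry scl ip M" and f: "continuous_map X (ip_topology ip) f"
  shows "continuous_map X (ip_topology ip) (\<lambda>x. M (f x))"
proof (rule continuous_map_into_ip_topologyI)
  interpret L: Vector_Spaces.linear scl scl M
    using M by (simp add: linear_isometry_def)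
  fix x
  show "\<exists>h. continuous_map X euclideanreal h \<and> h x = 0 \<and>
      (\<forall>y\<in>topspace X. ip_norm ip (M (f x) - M (f y)) \<le> h y)"
    using f M by (intro exI [of _ "\<lambda>y. ip_norm ip (f x - f y)"] conjI
        continuous_map_ip_norm_diff)
      (auto simp: ip_norm_eq_0_iff linear_isometry_def simp flip: L.diff)
qed

definition real_scalar_of :: "real \<Rightarrow> 'f" where
  "real_scalar_of r = (SOME a. to_complex a = complex_of_real r)"

lemma to_complex_real_scalar_of [simp]: "to_complex (real_scalar_of r) = complex_of_real r"
  unfolding real_scalar_of_def by (rule someI_ex) (rule real_scalar)

text \<open>
  Points of the product topology are extensional, so \<open>line\<close> has to be restricted to \<open>I\<close> to
  remain in that space.
\<close>

definition line :: "'i set \<Rightarrow> ('i \<Rightarrow> 'v) \<Rightarrow> ('i \<Rightarrow> 'v) \<Rightarrow> real \<Rightarrow> 'i \<Rightarrow> 'v" where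
  "line I v u t = (\<lambda>i\<in>I. v i + scl (real_scalar_of t) (u i))"

lemma continuous_map_line:
  "continuous_map euclideanreal (product_topology (\<lambda>i. ip_topology ip) I) (line I v u)"
proof -
  have "continuous_map euclideanreal (ip_topology ip) (\<lambda>t. x + scl (real_scalar_of t) y)" for x y
  proof (rule continuous_map_into_ip_topologyI)
    fix s :: real
    have "ip_norm ip (x + scl (real_scalar_of s) y - (x + scl (real_scalar_of t) y))
        = \<bar>s - t\<bar> * ip_norm ip y" for t
      by (simp add: ip_norm_scale to_complex_diff norm_of_real flip: scale_left_diff_distrib of_real_diff)
    then show "\<exists>h. continuous_map euclideanreal euclideanreal h \<and> h s = 0 \<and>
       (\<forall>t\<in>topspace euclideanreal. ip_norm ip (x + scl (real_scalar_of s) y -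
         (x + scl (real_scalar_of t) y)) \<le> h t)"
      by (intro exI [of _ "\<lambda>t. \<bar>s - t\<bar> * ip_norm ip y"]) (auto intro!: continuous_intros)
  qed
  then show ?thesis
    by (auto simp: continuous_map_componentwise line_def)
qed

text \<open>
  Real quadratic polynomial functions on a power of the space, described without coordinates:
  restricting to lines reduces questions about zeros to polynomials in one real variable, and
  continuity makes the nonvanishing locus open.
\<close>

definition real_quadratic :: "'i set \<Rightarrow> (('i \<Rightarrow> 'v) \<Rightarrow> real) \<Rightarrow> bool" where
  "real_quadratic I f \<longleftrightarrow>
     continuous_map (product_topology (\<lambda>i. ip_topology ip) I) euclideanreal f \<and>
     (\<forall>v u. \<exists>a b c. \<forall>t. f (line I v u t) = a + b * t + c * t\<^sup>2)"

lemma real_quadratic_diff: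
  assumes "real_quadratic I f" "real_quadratic I g"
  shows "real_quadratic I (\<lambda>v. f v - g v)"
proof -
  have "\<exists>a b c. \<forall>t. f (line I v u t) - g (line I v u t) = a + b * t + c * t\<^sup>2" for v u
  proof -
    obtain a b c where "\<forall>t. f (line I v u t) = a + b * t + c * t\<^sup>2"
      using assms(1) unfolding real_quadratic_def by blast
    moreover obtain a' b' c' where "\<forall>t. g (line I v u t) = a' + b' * t + c' * t\<^sup>2"
      using assms(2) unfolding real_quadratic_def by blast
    ultimately have "f (line I v u t) - g (line I v u t) = (a - a') + (b - b') * t + (c - c') * t\<^sup>2" for t
      by (simp add: algebra_simps)
    then show ?thesis by blast
  qed
  then show ?thesis
    using assms unfolding real_quadratic_def by (intro conjI allI continuous_map_diff) auto
qed

lemma real_quadratic_Re_ip: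
  assumes "i \<in> I" "j \<in> I" "linear_isometry scl ip M"
  shows "real_quadratic I (\<lambda>v. Re_ip (scl a (v i)) (M (v j)))"
proof -
  interpret L: Vector_Spaces.linear scl scl M
    using assms(3) by (simp add: linear_isometry_def)
  have s: "Re_ip (scl (real_scalar_of t) x) y = t * Re_ip x y" for t x y
    by (simp add: ip_scale_left to_complex_mult)
  have s': "Re_ip x (scl (real_scalar_of t) y) = t * Re_ip x y" for t x y
    by (simp add: to_complex_ip_scale_right)
  have expansion: "Re_ip (scl a (line I v u t i)) (M (line I v u t j))
      = Re_ip (scl a (v i)) (M (v j))
        + (Re_ip (scl a (v i)) (M (u j)) + Re_ip (scl a (u i)) (M (v j))) * t
        + Re_ip (scl a (u i)) (M (u j)) * t\<^sup>2" for v u t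
  proof -
    have "scl a (line I v u t i) = scl a (v i) + scl (real_scalar_of t) (scl a (u i))"
      using assms by (simp add: line_def scale_right_distrib mult.commute)
    moreover have "M (line I v u t j) = M (v j) + scl (real_scalar_of t) (M (u j))"
      using assms by (simp add: line_def L.add L.scale)
    ultimately show ?thesis
      by (simp only: Re_ip_add_left Re_ip_add_right s s')
        (simp add: power2_eq_square algebra_simps)
  qed
  have projection: "continuous_map (product_topology (\<lambda>i. ip_topology ip) I) (ip_topology ip)
      (\<lambda>v. v l)" if "l \<in> I" for l
    using that by (rule continuous_map_product_projection)
  have "continuous_map (product_topology (\<lambda>i. ip_topology ip) I) euclideanreal
      (\<lambda>v. Re_ip (scl a (v i)) (M (v j)))"
    by (rule continuous_map_Re_ip [OF continuous_map_scaled [OF projection [OF assms(1)]]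
      continuous_map_linear_isometry [OF assms(3) projection [OF assms(2)]]])
  then show ?thesis
    unfolding real_quadratic_def using expansion by (intro conjI allI exI)
qed

text \<open>
  Density: from any point \<open>v\<close> of an open set, follow the line towards \<open>w\<close>. Along it \<open>f\<close> is
  a polynomial that is nonzero at time \<open>1\<close>, so it has finitely many zeros, while the line
  remains in the open set for infinitely many times.
\<close>

lemma real_quadratic_generically_nonzero:
  assumes f: "real_quadratic I f" and w: "w \<in> extensional I" "f w \<noteq> 0"
  shows "holds_generically (product_topology (\<lambda>i. ip_topology ip) I) (\<lambda>v. f v \<noteq> 0)"
proof -
  define X where "X = product_topology (\<lambda>i::'a. ip_topology ip) I"
  define S where "S = {v \<in> topspace X. f v \<in> - {0}}"
  have top: "topspace X = extensional I"
    by (simp add: X_def PiE_UNIV_domain PiE_def)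
  have "openin X S"
    unfolding S_def
    using f by (intro openin_continuous_map_preimage) (auto simp: real_quadratic_def X_def)
  moreover have "S \<inter> U \<noteq> {}" if U: "openin X U" "U \<noteq> {}" for U
  proof -
    obtain v where v: "v \<in> U" using U(2) by blast
    then have "v \<in> extensional I" using openin_subset [OF U(1)] top by blast
    define l where "l = line I v (\<lambda>i. w i - v i)"
    have l: "continuous_map euclideanreal X l"
      unfolding l_def X_def by (rule continuous_map_line)
    have "real_scalar_of 0 = 0" "real_scalar_of 1 = 1"
      by (simp_all add: to_complex_zero to_complex_one flip: to_complex_eq_iff)
    then have "l 0 = v" "l 1 = w"
      using \<open>v \<in> extensional I\<close> w by (auto simp: l_def line_def fun_eq_iff extensional_def)
    obtain a b c where abc: "\<forall>t. f (l t) = a + b * t + c * t\<^sup>2"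
      using f unfolding real_quadratic_def l_def by blast
    have fin: "finite {t. f (l t) = 0}"
      using quadratic_finite_zeros [of a b 1 c] w \<open>l 1 = w\<close> abc by auto
    have "open {t. l t \<in> U}"
      using openin_continuous_map_preimage [OF l U(1)] by simp
    moreover have "0 \<in> {t. l t \<in> U}" using v \<open>l 0 = v\<close> by simp
    ultimately have "infinite {t. l t \<in> U}"
      using finite_imp_not_open by blast
    then obtain t where "l t \<in> U" "f (l t) \<noteq> 0"
      using fin by (metis (mono_tags, lifting) finite_subset mem_Collect_eq subsetI)
    then show ?thesis using openin_subset [OF U(1)] by (auto simp: S_def)
  qed
  ultimately show ?thesis
    unfolding holds_generically_def generic_set_def X_def [symmetric] dense_intersects_open
    by (intro exI [of _ S]) (auto simp: S_def)
qed


section \<open>Generic tuples separate the group elements\<close>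

text \<open>
  The inner products differ by a scalar that may be complex, while the density argument is
  about real functions. Multiplying the difference by the conjugate of its value \<open>d\<close> at \<open>w\<close> and
  taking real parts gives a real quadratic function whose value at \<open>w\<close> is \<open>(cmod d)\<^sup>2\<close>.
\<close>

lemma generically_ip_neq:
  assumes ij: "i \<in> I" "j \<in> I"
    and g: "linear_isometry scl ip g" and h: "linear_isometry scl ip h"
    and neq: "ip (w i) (g (w j)) \<noteq> ip (w i) (h (w j))"
  shows "holds_generically (product_topology (\<lambda>i. ip_topology ip) I)
    (\<lambda>v. ip (v i) (g (v j)) \<noteq> ip (v i) (h (v j)))"
proof -
  define d where "d = ip (w i) (g (w j)) - ip (w i) (h (w j))"
  define a where "a = ip (g (w j)) (w i) - ip (h (w j)) (w i)"
  define f where "f v = Re_ip (scl a (v i)) (g (v j)) - Re_ip (scl a (v i)) (h (v j))" for v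
  have f: "f v = Re (to_complex a * to_complex (ip (v i) (g (v j)) - ip (v i) (h (v j))))" for v
    by (simp add: f_def ip_scale_left to_complex_mult to_complex_diff algebra_simps)
  have a: "to_complex a = cnj (to_complex d)"
    unfolding a_def d_def to_complex_diff complex_cnj_diff by (metis ip_cnj)
  have "to_complex d \<noteq> 0" using neq by (simp add: to_complex_eq_0_iff d_def)
  have "f w = (cmod (to_complex d))\<^sup>2"
    unfolding f d_def [symmetric] a
    by (simp only: cmod_power2) (simp add: power2_eq_square)
  then have "f (restrict w I) \<noteq> 0"
    using ij \<open>to_complex d \<noteq> 0\<close> by (simp add: f_def)
  then have "holds_generically (product_topology (\<lambda>i. ip_topology ip) I) (\<lambda>v. f v \<noteq> 0)"
    unfolding f_def
    by (intro real_quadratic_generically_nonzero [where w = "restrict w I"]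
        real_quadratic_diff real_quadratic_Re_ip ij g h) auto
  then show ?thesis
    by (rule holds_generically_mono) (auto simp: f to_complex_zero)
qed

lemma generically_separating:
  assumes ij: "i \<in> I" "j \<in> I"
    and g: "linear_isometry scl ip g" and h: "linear_isometry scl ip h" and "g \<noteq> h"
    and "i \<noteq> j \<or> range (to_complex :: 'f \<Rightarrow> complex) = UNIV"
  shows "holds_generically (product_topology (\<lambda>i. ip_topology ip) I)
    (\<lambda>v. ip (v i) (g (v j)) \<noteq> ip (v i) (h (v j)))"
proof -
  have "\<exists>w. ip (w i) (g (w j)) \<noteq> ip (w i) (h (w j))"
  proof (cases "i = j")
    case True
    then have surj: "range (to_complex :: 'f \<Rightarrow> complex) = UNIV" using assms by simp
    obtain x where "ip x (g x) \<noteq> ip x (h x)"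
      using complex_ip_eqI [OF surj, of g h] g h \<open>g \<noteq> h\<close> by (auto simp: linear_isometry_def)
    then show ?thesis by (intro exI [of _ "\<lambda>_. x"])
  next
    case False
    obtain x where x: "g x \<noteq> h x" using \<open>g \<noteq> h\<close> by blast
    then have "ip (g x - h x) (g x) \<noteq> ip (g x - h x) (h x)"
      using ip_self_eq_0_iff [of "g x - h x"] by (simp add: ip_diff_right)
    then show ?thesis
      using False by (intro exI [of _ "(\<lambda>_. x)(i := g x - h x)"]) simp
  qed
  then show ?thesis using generically_ip_neq [OF ij g h] by blast
qed

text \<open>
  The implication, rather than an inequality of norms, keeps the statement true in the
  zero space, where all vectors are equal.
\<close>

lemma generically_distinct_norms:
  assumes ij: "i \<in> I" "j \<in> I"
  shows "holds_generically (product_topology (\<lambda>i. ip_topology ip) I)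
    (\<lambda>v. ip_norm ip (v i) = ip_norm ip (v j) \<longrightarrow> v i = v j)"
proof (cases "i = j \<or> (\<forall>x::'v. x = 0)")
  case True
  then show ?thesis
  proof
    assume "\<forall>x::'v. x = 0"
    then have "x = y" for x y :: 'v by metis
    then show ?thesis by (intro holds_generically_everywhere) blast
  qed (intro holds_generically_everywhere, blast)
next
  case False
  then obtain x :: 'v where "x \<noteq> 0" and "i \<noteq> j" by blast
  \<comment> \<open>The factors \<open>1\<close> bring the squared norms into the shape of \<open>real_quadratic_Re_ip\<close>.\<close>
  define f where "f v = Re_ip (scl 1 (v i)) (v i) - Re_ip (scl 1 (v j)) (v j)" for v
  define w where "w = (\<lambda>_\<in>I. 0)(i := x)"
  have "f w = Re_ip x x"
    using ij \<open>i \<noteq> j\<close> by (simp add: f_def w_def Re_ip_zero)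
  then have "f w \<noteq> 0" using ip_pos [OF \<open>x \<noteq> 0\<close>] by simp
  then have "holds_generically (product_topology (\<lambda>i. ip_topology ip) I) (\<lambda>v. f v \<noteq> 0)"
    unfolding f_def using ij
    by (intro real_quadratic_generically_nonzero [where w = w] real_quadratic_diff
        real_quadratic_Re_ip [where M = "\<lambda>x. x"] linear_isometry_id)
      (auto simp: w_def extensional_def)
  then show ?thesis
    by (rule holds_generically_mono) (auto simp: f_def simp flip: ip_norm_power2)
qed


section \<open>Automorphisms of a separating union of orbits\<close>

lemma Aut_UNIV_linear_isometry:
  assumes "g \<in> carrier (Aut scl ip UNIV)"
  shows "linear_isometry scl ip g"
proof -
  obtain M where "linear_isometry scl ip M" "\<forall>x. M x = g x"
    using assms by (auto simp: Aut_def)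
  moreover from this have "M = g" by blast
  ultimately show ?thesis by simp
qed

text \<open>
  The image of \<open>h (v j)\<close> lies in the orbit of some \<open>v l\<close> with the same norm as \<open>v j\<close>, and equal
  norms force \<open>v l = v j\<close>.
\<close>

lemma isometry_preserves_orbits:
  fixes v :: "nat \<Rightarrow> 'v"
  assumes isom: "\<And>g. g \<in> G \<Longrightarrow> linear_isometry scl ip g"
    and norms: "\<And>i j. i < k \<Longrightarrow> j < k \<Longrightarrow> ip_norm ip (v i) = ip_norm ip (v j) \<Longrightarrow> v i = v j"
    and N: "linear_isometry scl ip N"
    and maps: "\<And>x. x \<in> (\<Union>i<k. orbit_of G (v i)) \<Longrightarrow> N x \<in> (\<Union>i<k. orbit_of G (v i))"
    and j: "j < k" and h: "h \<in> G"
  shows "\<exists>h'\<in>G. N (h (v j)) = h' (v j)"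
proof -
  have "h (v j) \<in> (\<Union>i<k. orbit_of G (v i))" using j h by (auto simp: orbit_of_def)
  then obtain l h' where l: "l < k" "h' \<in> G" "N (h (v j)) = h' (v l)"
    using maps [of "h (v j)"] by (auto simp: orbit_of_def)
  have "ip_norm ip (v j) = ip_norm ip (h (v j))"
    using isom [OF h] by (simp add: linear_isometry_def)
  also have "\<dots> = ip_norm ip (h' (v l))"
    using N l by (metis linear_isometry_def)
  also have "\<dots> = ip_norm ip (v l)"
    using isom [OF l(2)] by (simp add: linear_isometry_def)
  finally have "v j = v l" using norms j l by blast
  then show ?thesis using l by auto
qed

text \<open>
  Rigidity: once \<open>v i\<close> is fixed, a pair \<open>(i, j)\<close> that separates \<open>G\<close> forces the orbit of \<open>v j\<close> to
  be fixed pointwise, because the isometry permutes this orbit and preserves the inner products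
  with \<open>v i\<close>.
\<close>

lemma isometry_fixes_orbits:
  fixes v :: "nat \<Rightarrow> 'v"
  assumes isom: "\<And>g. g \<in> G \<Longrightarrow> linear_isometry scl ip g"
    and one: "(\<lambda>x. x) \<in> G" and "k > 0"
    and norms: "\<And>i j. i < k \<Longrightarrow> j < k \<Longrightarrow> ip_norm ip (v i) = ip_norm ip (v j) \<Longrightarrow> v i = v j"
    and separating: "\<And>i j g h. i < k \<Longrightarrow> j < k \<Longrightarrow> i \<noteq> j \<or> k = 1 \<Longrightarrow> g \<in> G \<Longrightarrow> h \<in> G \<Longrightarrow>
      ip (v i) (g (v j)) = ip (v i) (h (v j)) \<Longrightarrow> g = h"
    and N: "linear_isometry scl ip N"
    and maps: "\<And>x. x \<in> (\<Union>i<k. orbit_of G (v i)) \<Longrightarrow> N x \<in> (\<Union>i<k. orbit_of G (v i))"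
    and N0: "N (v 0) = v 0"
    and x: "x \<in> (\<Union>i<k. orbit_of G (v i))"
  shows "N x = x"
proof -
  have fix_orbit: "N (h (v j)) = h (v j)"
    if "i < k" "j < k" "i \<noteq> j \<or> k = 1" "h \<in> G" and fixed: "N (v i) = v i" for i j h
  proof -
    obtain h' where h': "h' \<in> G" "N (h (v j)) = h' (v j)"
      using isometry_preserves_orbits [OF isom norms N maps \<open>j < k\<close> \<open>h \<in> G\<close>] by blast
    have "ip (v i) (h (v j)) = ip (N (v i)) (N (h (v j)))"
      by (simp add: linear_isometry_ip [OF N])
    also have "\<dots> = ip (v i) (h' (v j))" by (simp add: fixed h')
    finally have "h = h'" using separating that h' by blast
    then show ?thesis using h' by simp
  qed
  have "N (h (v j)) = h (v j)" if "j < k" "h \<in> G" for j h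
  proof (cases "j \<noteq> 0 \<or> k = 1")
    case True
    then show ?thesis using fix_orbit [of 0 j h] that N0 \<open>k > 0\<close> by auto
  next
    case False
    \<comment> \<open>The pair \<open>(0, 0)\<close> need not separate \<open>G\<close> over the reals. By the first case \<open>N\<close>
      fixes \<open>v 1\<close>, and \<open>v 1\<close> separates the points of the orbit of \<open>v 0\<close>.\<close>
    then have "j = 0" "k \<noteq> 1" by auto
    then have "1 < k" using \<open>k > 0\<close> by linarith
    then have "N (v 1) = v 1" using fix_orbit [of 0 1 "\<lambda>x. x"] N0 one by auto
    then show ?thesis using fix_orbit [of 1 0 h] \<open>1 < k\<close> \<open>j = 0\<close> that by auto
  qed
  then show ?thesis using x by (auto simp: orbit_of_def)
qed

text \<open>
  Injectivity is immediate from separation. Surjectivity is rigidity applied to the given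
  isometry followed by the inverse of the group element \<open>g\<close> that has the same value at \<open>v 0\<close>.
\<close>

lemma restriction_iso:
  fixes v :: "nat \<Rightarrow> 'v"
  assumes G: "subgroup G (Aut scl ip UNIV)" and "k > 0"
    and norms: "\<And>i j. i < k \<Longrightarrow> j < k \<Longrightarrow> ip_norm ip (v i) = ip_norm ip (v j) \<Longrightarrow> v i = v j"
    and separating: "\<And>i j g h. i < k \<Longrightarrow> j < k \<Longrightarrow> i \<noteq> j \<or> k = 1 \<Longrightarrow> g \<in> G \<Longrightarrow> h \<in> G \<Longrightarrow>
      ip (v i) (g (v j)) = ip (v i) (h (v j)) \<Longrightarrow> g = h"
  defines "S \<equiv> \<Union>i<k. orbit_of G (v i)"
  shows "(\<lambda>g\<in>G. restrict g S) \<in> iso ((Aut scl ip UNIV)\<lparr>carrier := G\<rparr>) (Aut scl ip S)"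
proof -
  have carrier: "G \<subseteq> carrier (Aut scl ip UNIV)" using G by (rule subgroup.subset)
  have isom: "linear_isometry scl ip g" if "g \<in> G" for g
    using that carrier Aut_UNIV_linear_isometry by blast
  have Bij: "g \<in> Bij UNIV" if "g \<in> G" for g using that carrier by (auto simp: Aut_def)
  have one: "(\<lambda>x. x) \<in> G"
    using subgroup.one_closed [OF G] by (simp add: Aut_def BijGroup_def restrict_UNIV)
  have mult: "g \<otimes>\<^bsub>Aut scl ip UNIV\<^esub> h = (\<lambda>x. g (h x))" if "g \<in> G" "h \<in> G" for g h
    using that Bij by (simp add: Aut_def BijGroup_def compose_def restrict_def)
  have closed: "(\<lambda>x. g (h x)) \<in> G" if "g \<in> G" "h \<in> G" for g h
    using subgroup.m_closed [OF G that] mult [OF that] by simp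
  have inverse: "\<exists>g'\<in>G. (\<forall>x. g' (g x) = x) \<and> (\<forall>x. g (g' x) = x)" if "g \<in> G" for g
  proof -
    interpret A: group "Aut scl ip UNIV" by (rule group_Aut)
    let ?g' = "inv\<^bsub>Aut scl ip UNIV\<^esub> g"
    have g': "?g' \<in> G" using subgroup.m_inv_closed [OF G that] .
    have g: "g \<in> carrier (Aut scl ip UNIV)" using that carrier by blast
    have id: "\<one>\<^bsub>Aut scl ip UNIV\<^esub> = (\<lambda>x. x)"
      by (simp add: Aut_def BijGroup_def restrict_def)
    have "(\<lambda>x. ?g' (g x)) = (\<lambda>x. x)"
      using A.l_inv [OF g] unfolding mult [OF g' that] id .
    moreover have "(\<lambda>x. g (?g' x)) = (\<lambda>x. x)"
      using A.r_inv [OF g] unfolding mult [OF that g'] id .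
    ultimately show ?thesis using g' by (intro bexI [of _ ?g']) (simp_all add: fun_eq_iff)
  qed
  have S_iff: "x \<in> S \<longleftrightarrow> (\<exists>i<k. \<exists>g\<in>G. x = g (v i))" for x
    by (auto simp: S_def orbit_of_def)
  have GS: "g x \<in> S" if "g \<in> G" "x \<in> S" for g x
  proof -
    obtain i h where i: "i < k" "h \<in> G" "x = h (v i)" using \<open>x \<in> S\<close> S_iff by blast
    then have "(\<lambda>x. g (h x)) \<in> G" using closed \<open>g \<in> G\<close> by blast
    then show ?thesis unfolding S_iff using i by (intro exI [of _ i] conjI bexI) auto
  qed
  have bij_S: "bij_betw g S S" if g: "g \<in> G" for g
  proof -
    obtain g' where "g' \<in> G" "\<forall>x. g' (g x) = x" "\<forall>x. g (g' x) = x" using inverse [OF g] by blast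
    then show ?thesis using GS g by (intro bij_betw_byWitness [of _ g']) auto
  qed
  have restrict_Bij: "restrict g S \<in> Bij S" if "g \<in> G" for g
    using bij_S [OF that] by (simp add: Bij_def bij_betw_restrict_eq)
  have restrict_Aut: "restrict g S \<in> carrier (Aut scl ip S)" if "g \<in> G" for g
    using restrict_Bij [OF that] isom [OF that] by (auto simp: Aut_def)
  have hom: "(\<lambda>g\<in>G. restrict g S) \<in> hom ((Aut scl ip UNIV)\<lparr>carrier := G\<rparr>) (Aut scl ip S)"
  proof (rule homI)
    fix g h
    assume "g \<in> carrier ((Aut scl ip UNIV)\<lparr>carrier := G\<rparr>)"
      "h \<in> carrier ((Aut scl ip UNIV)\<lparr>carrier := G\<rparr>)"
    then have gh: "g \<in> G" "h \<in> G" by simp_all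
    have "restrict (\<lambda>x. g (h x)) S = compose S (restrict g S) (restrict h S)"
      using GS gh by (auto simp: compose_def fun_eq_iff)
    also have "\<dots> = restrict g S \<otimes>\<^bsub>Aut scl ip S\<^esub> restrict h S"
      using restrict_Bij gh by (simp add: Aut_def BijGroup_def)
    finally show "(\<lambda>g\<in>G. restrict g S) (g \<otimes>\<^bsub>(Aut scl ip UNIV)\<lparr>carrier := G\<rparr>\<^esub> h)
        = (\<lambda>g\<in>G. restrict g S) g \<otimes>\<^bsub>Aut scl ip S\<^esub> (\<lambda>g\<in>G. restrict g S) h"
      using gh closed by (simp add: mult)
  qed (use restrict_Aut in simp)
  have "inj_on (\<lambda>g\<in>G. restrict g S) G"
  proof (rule inj_onI)
    fix g h assume gh: "g \<in> G" "h \<in> G"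
      and eq: "(\<lambda>g\<in>G. restrict g S) g = (\<lambda>g\<in>G. restrict g S) h"
    have vS: "v j \<in> S" if "j < k" for j
      unfolding S_iff using one that by (intro exI [of _ j] conjI bexI) auto
    have "restrict g S = restrict h S" using eq gh by simp
    then have "g (v j) = h (v j)" if "j < k" for j
      using vS [OF that] by (metis restrict_apply')
    \<comment> \<open>\<open>(0, 0)\<close> if \<open>k = 1\<close>, otherwise \<open>(0, 1)\<close>\<close>
    moreover obtain i j where "i < k" "j < k" "i \<noteq> j \<or> k = 1"
      using \<open>k > 0\<close> by (metis One_nat_def less_one linorder_neqE_nat nat_neq_iff zero_neq_one)
    ultimately show "g = h" using separating [of i j g h] gh by metis
  qed
  moreover have "\<sigma> \<in> (\<lambda>g\<in>G. restrict g S) ` G" if \<sigma>_Aut: "\<sigma> \<in> carrier (Aut scl ip S)" for \<sigma>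
  proof -
    obtain M where \<sigma>: "\<sigma> \<in> Bij S" and M: "linear_isometry scl ip M" "\<forall>x\<in>S. M x = \<sigma> x"
      using \<sigma>_Aut by (auto simp: Aut_def)
    have MS: "M x \<in> S" if "x \<in> S" for x
      using that M \<sigma> Bij_imp_funcset by fastforce
    obtain g where g: "g \<in> G" "M (v 0) = g (v 0)"
      using isometry_preserves_orbits [OF isom norms M(1) MS [unfolded S_def] \<open>k > 0\<close> one] by blast
    obtain g' where g': "g' \<in> G" "\<forall>x. g' (g x) = x" "\<forall>x. g (g' x) = x"
      using inverse g by blast
    define N where "N = (\<lambda>x. g' (M x))"
    have N: "linear_isometry scl ip N"
      unfolding N_def using isom [OF g'(1)] M(1) by (rule linear_isometry_comp)
    have NS: "N x \<in> S" if "x \<in> S" for x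
      unfolding N_def using g'(1) MS [OF that] by (rule GS)
    have N0: "N (v 0) = v 0" using g g' by (simp add: N_def)
    have "N x = x" if "x \<in> S" for x
      by (rule isometry_fixes_orbits [OF isom one \<open>k > 0\<close> norms separating N
          NS [unfolded S_def] N0 that [unfolded S_def]])
    then have "\<sigma> x = g x" if "x \<in> S" for x
      using that M(2) g'(3) unfolding N_def by metis
    then have "\<sigma> = restrict g S"
      using Bij_imp_extensional [OF \<sigma>] by (auto simp: fun_eq_iff extensional_def)
    then show ?thesis using g(1) by force
  qed
  ultimately have "bij_betw (\<lambda>g\<in>G. restrict g S) G (carrier (Aut scl ip S))"
    using restrict_Aut by (auto simp: bij_betw_def)
  then show ?thesis using hom by (simp add: iso_def)
qed

end

theorem theorem3p2:
  fixes scl :: "'f::real_or_complex \<Rightarrow> 'v::ab_group_add \<Rightarrow> 'v"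
    and ip :: "'v \<Rightarrow> 'v \<Rightarrow> 'f"
    and G :: "('v \<Rightarrow> 'v) set"
    and k :: nat
  assumes "finite_dim_hilbert_space scl ip"
    and "subgroup G (Aut scl ip UNIV)"
    and "finite G"
    and "k > 0"
    and "k \<ge> complex_degree TYPE('f)"
  shows "holds_generically (product_topology (\<lambda>i. ip_topology ip) {..<k})
    (\<lambda>v. let S = (\<Union>i<k. orbit_of G (v i)) in
       (\<lambda>g\<in>G. restrict g S) \<in> iso ((Aut scl ip UNIV)\<lparr>carrier := G\<rparr>) (Aut scl ip S))"
proof -
  interpret finite_dim_hilbert_space scl ip by fact
  define X where "X = product_topology (\<lambda>i::nat. ip_topology ip) {..<k}"
  define P where "P = (\<lambda>(i, j, g, h) (v :: nat \<Rightarrow> 'v).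
    (i \<noteq> j \<or> k = 1) \<and> g \<noteq> h \<longrightarrow> ip (v i) (g (v j)) \<noteq> ip (v i) (h (v j)))"
  define Q where "Q = (\<lambda>(i, j) (v :: nat \<Rightarrow> 'v).
    ip_norm ip (v i) = ip_norm ip (v j) \<longrightarrow> v i = v j)"
  have surj: "range (to_complex :: 'f \<Rightarrow> complex) = UNIV" if "k = 1"
    using assms(5) that range_to_complex [where 'a = 'f] complex_degree_eq_2 [where 'f = 'f] by auto
  have isom: "linear_isometry scl ip g" if "g \<in> G" for g
    using that subgroup.subset [OF assms(2)] Aut_UNIV_linear_isometry by blast
  have "holds_generically X (P q)" if "q \<in> {..<k} \<times> {..<k} \<times> G \<times> G" for q
  proof -
    obtain i j g h where q: "q = (i, j, g, h)" by (cases q)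
    show ?thesis
    proof (cases "(i \<noteq> j \<or> k = 1) \<and> g \<noteq> h")
      case True
      then have "holds_generically X (\<lambda>v. ip (v i) (g (v j)) \<noteq> ip (v i) (h (v j)))"
        unfolding X_def using that surj True isom
        by (intro generically_separating) (auto simp: q)
      then show ?thesis by (rule holds_generically_mono) (simp add: P_def q)
    next
      case False
      then show ?thesis by (intro holds_generically_everywhere) (auto simp: P_def q)
    qed
  qed
  then have P: "holds_generically X (\<lambda>v. \<forall>q \<in> {..<k} \<times> {..<k} \<times> G \<times> G. P q v)"
    using assms(3) by (intro holds_generically_ball) auto
  have Q: "holds_generically X (\<lambda>v. \<forall>q \<in> {..<k} \<times> {..<k}. Q q v)"
    using generically_distinct_norms [of _ "{..<k}"]
    by (intro holds_generically_ball) (auto simp: X_def Q_def)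
  show ?thesis
    unfolding X_def [symmetric]
  proof (rule holds_generically_mono [OF holds_generically_conj [OF P Q]])
    fix v
    assume v: "(\<forall>q \<in> {..<k} \<times> {..<k} \<times> G \<times> G. P q v) \<and> (\<forall>q \<in> {..<k} \<times> {..<k}. Q q v)"
    show "let S = \<Union>i<k. orbit_of G (v i) in
        (\<lambda>g\<in>G. restrict g S) \<in> iso ((Aut scl ip UNIV)\<lparr>carrier := G\<rparr>) (Aut scl ip S)"
      unfolding Let_def
    proof (rule restriction_iso [OF assms(2,4)])
      show "v i = v j" if "i < k" "j < k" "ip_norm ip (v i) = ip_norm ip (v j)" for i j
      proof -
        have "Q (i, j) v" using v that by blast
        then show ?thesis using that by (simp add: Q_def)
      qed
      show "g = h" if "i < k" "j < k" "i \<noteq> j \<or> k = 1" "g \<in> G" "h \<in> G"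
          "ip (v i) (g (v j)) = ip (v i) (h (v j))" for i j g h
      proof -
        have "P (i, j, g, h) v" using v that by blast
        then show ?thesis using that by (auto simp: P_def)
      qed
    qed
  qed
qed

end
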